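(* Let $\tau,t\in\mathbb{R}$ and let $\beta_n=\beta_n(\tau,t)$, $n\ge1$, be the recurrence coefficients of the monic orthogonal polynomials for the weight $\omega(x;\tau,t)=\exp(-x^6+\tau x^4+tx^2)$ on $\mathbb{R}$. For each sufficiently large $n$, let $\beta(n)$ denote the unique real root of the cubic $$60\beta^3-12\tau\beta^2-2t\beta=n,$$ which is positive. Then $\displaystyle\lim_{n\to\infty}\frac{\beta_n}{\beta(n)}=1$.
   Context: The monic polynomials $P_n(x)$ of exact degree $n$ satisfy $\int_{-\infty}^{\infty}P_m(x)P_n(x)\,\omega(x;\tau,t)\,dx=h_n\delta_{mn}$ with $h_n>0$. Since the weight is even, they satisfy the three-term recurrence $P_{n+1}(x)=xP_n(x)-\beta_nP_{n-1}(x)$ with $P_{-1}=0$, $P_0=1$, and $\beta_n=h_n/h_{n-1}>0$ for $n\ge1$. *)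

theory Defs
  imports "HOL-Analysis.Analysis" "HOL-Computational_Algebra.Polynomial"
begin

definition weight :: "real \<Rightarrow> real \<Rightarrow> real \<Rightarrow> real" where
  "weight \<tau> t x = exp (- (x ^ 6) + \<tau> * x ^ 4 + t * x ^ 2)"

definition wip :: "(real \<Rightarrow> real) \<Rightarrow> real poly \<Rightarrow> real poly \<Rightarrow> real" where
  "wip w p q = (LINT x|lborel. poly p x * poly q x * w x)"

definition monic_OPS :: "(real \<Rightarrow> real) \<Rightarrow> (nat \<Rightarrow> real poly) \<Rightarrow> bool" where
  "monic_OPS w P \<longleftrightarrow>
     (\<forall>n. degree (P n) = n \<and> lead_coeff (P n) = 1) \<and>
     (\<forall>m n. m \<noteq> n \<longrightarrow> wip w (P m) (P n) = 0)"

definition hnorm :: "(real \<Rightarrow> real) \<Rightarrow> (nat \<Rightarrow> real poly) \<Rightarrow> nat \<Rightarrow> real" where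
  "hnorm w P n = wip w (P n) (P n)"

definition rec_coeff :: "(real \<Rightarrow> real) \<Rightarrow> (nat \<Rightarrow> real poly) \<Rightarrow> nat \<Rightarrow> real" where
  "rec_coeff w P n = hnorm w P n / hnorm w P (n - 1)"

definition cubic :: "real \<Rightarrow> real \<Rightarrow> real \<Rightarrow> real" where
  "cubic \<tau> t b = 60 * b ^ 3 - 12 * \<tau> * b ^ 2 - 2 * t * b"

text \<open>beta(n): the (for large n unique) real root of cubic = n.\<close>
definition beta_root :: "real \<Rightarrow> real \<Rightarrow> nat \<Rightarrow> real" where
  "beta_root \<tau> t n = (THE b. cubic \<tau> t b = real n)"

end

theory Submission
  imports Defs "HOL-Probability.Distributions" "HOL-Real_Asymp.Real_Asymp"
begin

text \<open>
  Integrating \<open>(P\<^sub>n P\<^sub>n\<^sub>-\<^sub>1 \<omega>)'\<close> over the line and expanding with the three-term recurrence gives the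
  string equation, a nonlinear recurrence in which \<open>\<beta>\<^sub>n\<^sub>-\<^sub>2, \<dots>, \<beta>\<^sub>n\<^sub>+\<^sub>2\<close> occur in a cubic form with positive
  coefficients, plus terms of lower order carrying \<open>\<tau>\<close> and \<open>t\<close>. Positivity forces \<open>\<beta>\<^sub>n = O(n\<^sup>1\<^sup>/\<^sup>3)\<close>.
  Let \<open>a\<close> and \<open>A\<close> be the lower and upper limits of \<open>\<beta>\<^sub>n / n\<^sup>1\<^sup>/\<^sup>3\<close>. Taking the string equation along indices
  where the quotient approaches \<open>A\<close>, and along indices where it approaches \<open>a\<close>, and bounding the
  neighbours by \<open>a\<close> and \<open>A\<close> respectively, yields
  \<open>A(A\<^sup>2 + 4aA + 5a\<^sup>2) \<le> 1/6 \<le> a(a\<^sup>2 + 4aA + 5A\<^sup>2)\<close>, that is, \<open>(A - a)(A\<^sup>2 + a\<^sup>2) \<le> 0\<close>. Hence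
  \<open>a = A\<close> and \<open>60 A\<^sup>3 = 1\<close>, which is also the leading asymptotics of the root of the cubic.
\<close>

section \<open>The weight\<close>

lemma weight_pos: "weight \<tau> t x > 0"
  by (simp add: weight_def)

lemma weight_minus [simp]: "weight \<tau> t (- x) = weight \<tau> t x"
  by (simp add: weight_def)

text \<open>Beyond \<open>B\<close> the leading term wins: \<open>y \<ge> 1\<close> gives
  \<open>\<bar>b\<bar> * y \<le> \<bar>b\<bar> * y ^ 2\<close>, and
  \<open>y > \<bar>a\<bar> + \<bar>b\<bar>\<close> then gives domination by \<open>y ^ 3\<close>.
  Below \<open>B\<close> the lower-order terms are bounded by their value at
  \<open>B\<close>.\<close>

lemma neg_cubic_bounded_above:
  fixes a b :: real
  obtains K where "\<And>y. y \<ge> 0 \<Longrightarrow> - (y ^ 3) + a * y ^ 2 + b * y \<le> K"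
proof
  define B where "B = 1 + \<bar>a\<bar> + \<bar>b\<bar>"
  fix y :: real assume y: "y \<ge> 0"
  have le: "a * y ^ 2 + b * y \<le> \<bar>a\<bar> * y ^ 2 + \<bar>b\<bar> * y"
    using y by (intro add_mono mult_right_mono) auto
  have B0: "B \<ge> 1" by (simp add: B_def)
  show "- (y ^ 3) + a * y ^ 2 + b * y \<le> \<bar>a\<bar> * B ^ 2 + \<bar>b\<bar> * B"
  proof (cases "y \<le> B")
    case True
    have "\<bar>a\<bar> * y ^ 2 + \<bar>b\<bar> * y \<le> \<bar>a\<bar> * B ^ 2 + \<bar>b\<bar> * B"
      using y True by (intro add_mono mult_left_mono power_mono) auto
    moreover have "y ^ 3 \<ge> 0" using y by simp
    ultimately show ?thesis using le by linarith
  next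
    case False
    have "y * 1 \<le> y * y" using False B0 y by (intro mult_left_mono) auto
    then have "\<bar>b\<bar> * y \<le> \<bar>b\<bar> * y ^ 2"
      by (intro mult_left_mono) (auto simp: power2_eq_square)
    then have "\<bar>a\<bar> * y ^ 2 + \<bar>b\<bar> * y \<le> (\<bar>a\<bar> + \<bar>b\<bar>) * y ^ 2"
      by (simp add: algebra_simps)
    also have "\<dots> \<le> y * y ^ 2"
      using False by (intro mult_right_mono) (auto simp: B_def)
    finally have "\<bar>a\<bar> * y ^ 2 + \<bar>b\<bar> * y \<le> y ^ 3"
      by (simp add: power3_eq_cube power2_eq_square)
    moreover have "\<bar>a\<bar> * B ^ 2 + \<bar>b\<bar> * B \<ge> 0"
      using B0 by simp
    ultimately show ?thesis using le by linarith
  qed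
qed

text \<open>With \<open>y = x ^ 2\<close> the exponent is a cubic in \<open>y\<close>; adding 1/2 to
  \<open>t\<close> reserves the term \<open>x ^ 2 / 2\<close> for the Gaussian. All integrability
  and decay is inherited from this comparison.\<close>

lemma weight_le_gaussian:
  obtains C where "C > 0" "\<And>x. weight \<tau> t x \<le> C * std_normal_density x"
proof -
  obtain K where K: "\<And>y. y \<ge> 0 \<Longrightarrow> - (y ^ 3) + \<tau> * y ^ 2 + (t + 1/2) * y \<le> K"
    using neg_cubic_bounded_above[of \<tau> "t + 1/2"] by blast
  have "weight \<tau> t x \<le> (exp K * sqrt (2 * pi)) * std_normal_density x" for x
  proof -
    have "- (x ^ 6) + \<tau> * x ^ 4 + t * x ^ 2 \<le> K - x ^ 2 / 2"
      using K[of "x ^ 2"] by (simp add: algebra_simps flip: power_mult)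
    then have "weight \<tau> t x \<le> exp (K - x ^ 2 / 2)"
      by (simp add: weight_def)
    also have "\<dots> = (exp K * sqrt (2 * pi)) * std_normal_density x"
      by (simp add: std_normal_density_def flip: exp_add)
    finally show ?thesis .
  qed
  then show ?thesis by (intro that[of "exp K * sqrt (2 * pi)"]) auto
qed

section \<open>Integrability and decay of polynomials times the weight\<close>

lemma weight_measurable [measurable]: "weight \<tau> t \<in> borel_measurable borel"
  unfolding weight_def by measurable

lemma poly_measurable [measurable]: "poly (p :: real poly) \<in> borel_measurable borel"
  by (intro borel_measurable_continuous_onI continuous_intros)

lemma integrable_poly_weight: "integrable lborel (\<lambda>x. poly p x * weight \<tau> t x)"
proof -
  obtain C where C: "C > 0" "\<And>x. weight \<tau> t x \<le> C * std_normal_density x"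
    using weight_le_gaussian by blast
  have "integrable lborel (\<lambda>x. x ^ k * weight \<tau> t x)" for k
  proof (rule Bochner_Integration.integrable_bound)
    show "integrable lborel (\<lambda>x. C * (std_normal_density x * x ^ k))"
      by (intro integrable_mult_right integrable_std_normal_moment)
    have "norm (x ^ k * weight \<tau> t x) \<le> norm (C * (std_normal_density x * x ^ k))" for x
    proof -
      have "norm (x ^ k * weight \<tau> t x) = \<bar>x\<bar> ^ k * weight \<tau> t x"
        using weight_pos[of \<tau> t x] by (simp add: abs_mult power_abs)
      also have "\<dots> \<le> \<bar>x\<bar> ^ k * (C * std_normal_density x)"
        using C(2)[of x] by (intro mult_left_mono) auto
      also have "\<dots> = norm (C * (std_normal_density x * x ^ k))"
        using C(1) by (simp add: abs_mult power_abs)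
      finally show ?thesis .
    qed
    then show "AE x in lborel. norm (x ^ k * weight \<tau> t x) \<le> norm (C * (std_normal_density x * x ^ k))"
      by simp
  qed simp
  then have "integrable lborel (\<lambda>x. \<Sum>k\<le>degree p. coeff p k * (x ^ k * weight \<tau> t x))"
    by (intro Bochner_Integration.integrable_sum integrable_mult_right)
  then show ?thesis
    by (simp add: poly_altdef sum_distrib_right mult.assoc)
qed

lemma poly_weight_tendsto_0: "(\<lambda>n. poly p (real n) * weight \<tau> t (real n)) \<longlonglongrightarrow> 0"
proof -
  obtain C where C: "C > 0" "\<And>x. weight \<tau> t x \<le> C * std_normal_density x"
    using weight_le_gaussian by blast
  have "(\<lambda>n. real n ^ k * weight \<tau> t (real n)) \<longlonglongrightarrow> 0" for k
  proof (rule tendsto_sandwich[where f = "\<lambda>_. 0"])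
    have lim: "((\<lambda>x::real. x ^ k * exp (- x\<^sup>2 / 2)) \<longlongrightarrow> 0) at_top"
      by real_asymp
    have "(\<lambda>n. C / sqrt (2 * pi) * (real n ^ k * exp (- (real n)\<^sup>2 / 2))) \<longlonglongrightarrow> 0"
      by (intro tendsto_mult_right_zero filterlim_compose[OF lim filterlim_real_sequentially])
    then show "(\<lambda>n. C * (real n ^ k * std_normal_density (real n))) \<longlonglongrightarrow> 0"
      by (simp add: std_normal_density_def field_simps)
    show "\<forall>\<^sub>F n in sequentially. 0 \<le> real n ^ k * weight \<tau> t (real n)"
      by (intro always_eventually allI mult_nonneg_nonneg less_imp_le[OF weight_pos]) simp
    have "real n ^ k * weight \<tau> t (real n) \<le> real n ^ k * (C * std_normal_density (real n))" for n
      by (intro mult_left_mono C(2)) simp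
    then show "\<forall>\<^sub>F n in sequentially. real n ^ k * weight \<tau> t (real n)
        \<le> C * (real n ^ k * std_normal_density (real n))"
      by (simp add: mult.left_commute)
  qed auto
  then have "(\<lambda>n. \<Sum>k\<le>degree p. coeff p k * (real n ^ k * weight \<tau> t (real n))) \<longlonglongrightarrow> 0"
    by (intro tendsto_null_sum tendsto_mult_right_zero)
  then show ?thesis
    by (simp add: poly_altdef sum_distrib_right mult.assoc)
qed

text \<open>The fundamental theorem on \<open>{- real n..real n}\<close> combined with dominated
  convergence, \<open>\<bar>f\<bar>\<close> being the majorant. Boundary values are therefore needed
  along integers only.\<close>

lemma integral_deriv_eq_0:
  fixes F f :: "real \<Rightarrow> real"
  assumes deriv: "\<And>x. (F has_real_derivative f x) (at x)"
    and cont: "\<And>x. isCont f x"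
    and int: "integrable lborel f"
    and top: "(\<lambda>n. F (real n)) \<longlonglongrightarrow> 0" and bot: "(\<lambda>n. F (- real n)) \<longlonglongrightarrow> 0"
  shows "(LINT x|lborel. f x) = 0"
proof -
  have "(\<lambda>n::nat. LINT x|lborel. f x * indicator {- real n..real n} x) \<longlonglongrightarrow> (LINT x|lborel. f x)"
  proof (rule integral_dominated_convergence[where w = "\<lambda>x. norm (f x)"])
    show "integrable lborel (\<lambda>x. norm (f x))"
      using int by simp
    show "AE x in lborel. (\<lambda>n. f x * indicator {- real n..real n} x) \<longlonglongrightarrow> f x"
    proof (rule AE_I2, rule tendsto_eventually)
      fix x :: real
      have "\<forall>\<^sub>F n in sequentially. \<bar>x\<bar> \<le> real n"
        using filterlim_real_sequentially by (simp add: filterlim_at_top)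
      then show "\<forall>\<^sub>F n in sequentially. f x * indicator {- real n..real n} x = f x"
        by eventually_elim (auto simp: indicator_def)
    qed
    show "AE x in lborel. norm (f x * indicator {- real n..real n} x) \<le> norm (f x)" for n :: nat
      by (auto simp: indicator_def)
  qed (use int in \<open>auto intro: borel_measurable_integrable\<close>)
  moreover have "(LINT x|lborel. f x * indicator {- real n..real n} x) = F (real n) - F (- real n)" for n :: nat
    by (rule integral_FTC_Icc_real) (use deriv cont in auto)
  moreover have "(\<lambda>n. F (real n) - F (- real n)) \<longlonglongrightarrow> 0"
    using tendsto_diff[OF top bot] by simp
  ultimately show ?thesis
    using LIMSEQ_unique by fastforce
qed

text \<open>A linear functional on polynomials, with \<open>wip\<close> as its value at a product.
  Multiplication by x, reflection and differentiation thereby become the operations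
  \<open>pCons 0\<close>, \<open>pcompose\<close> and \<open>pderiv\<close>.\<close>

definition weight_functional :: "real \<Rightarrow> real \<Rightarrow> real poly \<Rightarrow> real" where
  "weight_functional \<tau> t p = (LINT x|lborel. poly p x * weight \<tau> t x)"

section \<open>Linearity, parity, positivity and integration by parts for the functional\<close>

lemma weight_functional_add:
  "weight_functional \<tau> t (p + q) = weight_functional \<tau> t p + weight_functional \<tau> t q"
  by (simp add: weight_functional_def distrib_right integrable_poly_weight)

lemma weight_functional_smult:
  "weight_functional \<tau> t (smult c p) = c * weight_functional \<tau> t p"
  by (simp add: weight_functional_def mult.assoc)

lemma weight_functional_reflect:
  "weight_functional \<tau> t (p \<circ>\<^sub>p [:0, -1:]) = weight_functional \<tau> t p"
  using lborel_integral_real_affine[of "-1" "\<lambda>x. poly p x * weight \<tau> t x" 0]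
  by (simp add: weight_functional_def poly_pcompose)

text \<open>If the integral of the nonnegative integrand were 0, \<open>p\<close> would vanish
  almost everywhere, yet its root set is finite and hence null.\<close>

lemma weight_functional_square_pos:
  assumes "p \<noteq> 0"
  shows "weight_functional \<tau> t (p * p) > 0"
proof -
  have nonneg: "poly (p * p) x * weight \<tau> t x \<ge> 0" for x
    using weight_pos[of \<tau> t x] by simp
  have "weight_functional \<tau> t (p * p) \<noteq> 0"
  proof
    assume "weight_functional \<tau> t (p * p) = 0"
    then have "AE x in lborel. poly (p * p) x * weight \<tau> t x = 0"
      unfolding weight_functional_def
      using integral_nonneg_eq_0_iff_AE[OF integrable_poly_weight] nonneg by blast
    then have "AE x in lborel. x \<in> {x. poly p x = 0}"
      using weight_pos[of \<tau> t] by (auto simp: less_imp_neq[symmetric])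
    moreover have "AE x in lborel. x \<notin> {x. poly p x = 0}"
      using poly_roots_finite[OF assms]
      by (intro AE_not_in countable_imp_null_set_lborel countable_finite)
    ultimately have "AE x in (lborel :: real measure). False"
      by eventually_elim simp
    then show False
      by (simp add: AE_iff_measurable[OF _ refl])
  qed
  moreover have "weight_functional \<tau> t (p * p) \<ge> 0"
    unfolding weight_functional_def using nonneg by simp
  ultimately show ?thesis by simp
qed

text \<open>The weight is exp(-V) with V = x^6 - \<tau> x^4 - t x^2, and the polynomial on the right
  is V'. The identity says that the derivative (p' - V' p) exp(-V) of p exp(-V) integrates to
  0.\<close>

lemma weight_functional_pderiv:
  "weight_functional \<tau> t (pderiv p)
     = weight_functional \<tau> t ([:0, - 2 * t, 0, - 4 * \<tau>, 0, 6:] * p)"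
proof -
  let ?V = "[:0, - 2 * t, 0, - 4 * \<tau>, 0, 6:]"
  have "(LINT x|lborel. poly (pderiv p - ?V * p) x * weight \<tau> t x) = 0"
  proof (rule integral_deriv_eq_0)
    show "((\<lambda>x. poly p x * weight \<tau> t x) has_real_derivative
        poly (pderiv p - ?V * p) x * weight \<tau> t x) (at x)" for x
      unfolding weight_def
      by (auto intro!: derivative_eq_intros poly_DERIV simp: algebra_simps eval_nat_numeral)
    show "isCont (\<lambda>x. poly (pderiv p - ?V * p) x * weight \<tau> t x) x" for x
      unfolding weight_def by (intro continuous_intros)
    show "(\<lambda>n. poly p (- real n) * weight \<tau> t (- real n)) \<longlonglongrightarrow> 0"
      using poly_weight_tendsto_0[of "p \<circ>\<^sub>p [:0, -1:]" \<tau> t] by (simp add: poly_pcompose)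
  qed (intro integrable_poly_weight poly_weight_tendsto_0)+
  moreover have "pderiv p - ?V * p = pderiv p + smult (-1) (?V * p)"
    by (simp only: smult_minus_left smult_1_left diff_conv_add_uminus)
  ultimately have "weight_functional \<tau> t (pderiv p + smult (-1) (?V * p)) = 0"
    by (simp only: weight_functional_def)
  then show ?thesis
    unfolding weight_functional_add weight_functional_smult by simp
qed

section \<open>Orthogonal polynomials for an even functional\<close>

text \<open>Linearity, evenness and positivity of the functional carry the whole algebra below; the
  integral itself does not appear in it.\<close>

locale even_orthogonal_polys =
  fixes L :: "real poly \<Rightarrow> real" and P :: "nat \<Rightarrow> real poly"
  assumes L_add: "L (p + q) = L p + L q"
    and L_smult: "L (smult c p) = c * L p"
    and L_reflect: "L (p \<circ>\<^sub>p [:0, -1:]) = L p"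
    and L_square_pos: "p \<noteq> 0 \<Longrightarrow> L (p * p) > 0"
    and degree_P: "degree (P n) = n"
    and monic_P: "lead_coeff (P n) = 1"
    and orthogonal: "m \<noteq> n \<Longrightarrow> L (P m * P n) = 0"
begin

definition h :: "nat \<Rightarrow> real" where
  "h n = L (P n * P n)"

text \<open>At 0 truncated subtraction gives \<open>\<beta> 0 = 1\<close>, not the customary 0. The
  value is positive, so \<open>\<beta>_pos\<close> holds for every index, and the identities below
  use only indices from 1 on.\<close>

definition \<beta> :: "nat \<Rightarrow> real" where
  "\<beta> n = h n / h (n - 1)"

section \<open>Orthogonality, parity and the three-term recurrence\<close>

lemma L_0 [simp]: "L 0 = 0"
  using L_smult[of 0 0] by simp

lemma L_diff: "L (p - q) = L p - L q"
  using L_add[of "p - q" q] by simp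

lemma coeff_P_self [simp]: "coeff (P n) n = 1"
  using monic_P[of n] degree_P[of n] by simp

lemma coeff_P_eq_0: "n < i \<Longrightarrow> coeff (P n) i = 0"
  using degree_P[of n] by (simp add: coeff_eq_0)

lemma h_pos: "h n > 0"
  unfolding h_def by (rule L_square_pos) (metis coeff_P_self coeff_0 zero_neq_one)

lemma \<beta>_pos: "\<beta> n > 0"
  by (simp add: \<beta>_def h_pos)

lemma h_Suc: "h (Suc n) = \<beta> (Suc n) * h n"
  using h_pos[of n] by (simp add: \<beta>_def)

text \<open>The monic \<open>P j\<close> with \<open>j < k\<close> span the polynomials of degree
  below \<open>k\<close>. The degree bound is phrased by vanishing coefficients so that the zero
  polynomial and \<open>k = 0\<close> fit in.\<close>

lemma L_mult_eq_0:
  assumes "\<And>j. j < k \<Longrightarrow> L (r * P j) = 0"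
    and "\<And>i. i \<ge> k \<Longrightarrow> coeff q i = 0"
  shows "L (r * q) = 0"
  using assms
proof (induction k arbitrary: q)
  case 0
  then have "q = 0" by (intro poly_eqI) simp
  then show ?case by simp
next
  case (Suc k)
  \<comment> \<open>Since \<open>P k\<close> is monic, this removes the coefficient at
    \<open>k\<close> and lowers the degree bound by one.\<close>
  define q' where "q' = q - smult (coeff q k) (P k)"
  have q': "coeff q' i = 0" if "i \<ge> k" for i
    using that Suc.prems(2)[of i]
    by (cases "i = k") (auto simp: q'_def coeff_P_eq_0)
  have "L (r * q') = 0"
    by (rule Suc.IH) (simp_all add: Suc.prems(1) q')
  moreover have "r * q = r * q' + smult (coeff q k) (r * P k)"
    by (simp add: q'_def algebra_simps)
  ultimately show ?case
    using Suc.prems(1)[of k] by (simp add: L_add L_smult)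
qed

lemma L_P_mult_eq_0:
  assumes "\<And>i. i \<ge> n \<Longrightarrow> coeff q i = 0"
  shows "L (P n * q) = 0"
  by (rule L_mult_eq_0[where k = n]) (use assms orthogonal in auto)

lemma L_P_mult:
  assumes "\<And>i. i > n \<Longrightarrow> coeff q i = 0"
  shows "L (P n * q) = coeff q n * h n"
proof -
  have "L (P n * (q - smult (coeff q n) (P n))) = 0"
  proof (rule L_P_mult_eq_0)
    fix i assume "i \<ge> n"
    then show "coeff (q - smult (coeff q n) (P n)) i = 0"
      using assms[of i] by (cases "i = n") (auto simp: coeff_P_eq_0)
  qed
  then show ?thesis
    by (simp add: right_diff_distrib L_diff L_smult h_def)
qed

text \<open>Such an \<open>r\<close> is orthogonal to itself, against positivity. This is how the
  polynomial identities below are proved.\<close>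

lemma eq_0_if_orthogonal:
  assumes "\<And>j. j < k \<Longrightarrow> L (r * P j) = 0" and "\<And>i. i \<ge> k \<Longrightarrow> coeff r i = 0"
  shows "r = 0"
  using L_mult_eq_0[OF assms] L_square_pos[of r] by force

text \<open>The leading coefficients agree, so the difference has degree below \<open>n\<close>; it
  is orthogonal to each lower \<open>P j\<close> because evenness of \<open>L\<close> moves the
  reflection onto \<open>P j\<close>.\<close>

lemma P_reflect: "P n \<circ>\<^sub>p [:0, -1:] = smult ((-1) ^ n) (P n)"
proof -
  define D where "D = P n \<circ>\<^sub>p [:0, -1:] - smult ((-1) ^ n) (P n)"
  have "D = 0"
  proof (rule eq_0_if_orthogonal[where k = n])
    fix i assume "i \<ge> n"
    then show "coeff D i = 0"
      by (cases "i = n") (auto simp: D_def coeff_pcompose_linear coeff_P_eq_0)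
  next
    fix j assume j: "j < n"
    have "L (P n \<circ>\<^sub>p [:0, -1:] * P j) = L ((P n \<circ>\<^sub>p [:0, -1:] * P j) \<circ>\<^sub>p [:0, -1:])"
      by (simp add: L_reflect)
    also have "\<dots> = L (P n * (P j \<circ>\<^sub>p [:0, -1:]))"
      by (simp add: pcompose_mult pcompose_pCons flip: pcompose_assoc)
    also have "\<dots> = 0"
      using j by (intro L_P_mult_eq_0) (simp add: coeff_pcompose_linear coeff_P_eq_0)
    finally show "L (D * P j) = 0"
      using j by (simp add: D_def left_diff_distrib L_diff L_smult orthogonal)
  qed
  then show ?thesis by (simp add: D_def)
qed

text \<open>The argument is an odd polynomial. This is why the recurrence has no diagonal
  term.\<close>

lemma L_X_P_P: "L (pCons 0 (P n * P n)) = 0"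
proof -
  have "L (pCons 0 (P n * P n)) = L (pCons 0 (P n * P n) \<circ>\<^sub>p [:0, -1:])"
    by (simp add: L_reflect)
  also have "pCons 0 (P n * P n) \<circ>\<^sub>p [:0, -1:] = smult (-1) (pCons 0 (P n * P n))"
    by (simp add: pcompose_pCons pcompose_mult P_reflect flip: power_add)
  finally show ?thesis by (simp only: L_smult)
qed

text \<open>Leading terms cancel in \<open>R\<close>, and \<open>R\<close> is orthogonal to
  \<open>P j\<close>: by degree for \<open>j < n\<close>, by the choice of \<open>\<beta>\<close>
  for \<open>j = n\<close>, by parity for \<open>j = Suc n\<close>. Starting at \<open>Suc n\<close>
  avoids an index -1.\<close>

lemma three_term_recurrence:
  "pCons 0 (P (Suc n)) = P (Suc (Suc n)) + smult (\<beta> (Suc n)) (P n)"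
proof -
  define R where "R = pCons 0 (P (Suc n)) - P (Suc (Suc n)) - smult (\<beta> (Suc n)) (P n)"
  have "R = 0"
  proof (rule eq_0_if_orthogonal[where k = "Suc (Suc n)"])
    fix i assume "i \<ge> Suc (Suc n)"
    then show "coeff R i = 0"
      by (cases "i = Suc (Suc n)") (auto simp: R_def coeff_pCons coeff_P_eq_0 split: nat.split)
  next
    fix j assume j: "j < Suc (Suc n)"
    have R: "L (R * P j) = L (pCons 0 (P (Suc n) * P j)) - \<beta> (Suc n) * L (P n * P j)"
      using j by (simp add: R_def left_diff_distrib L_diff L_smult orthogonal)
    \<comment> \<open>The factor x is moved onto \<open>P j\<close>, whose degree then is at most
      \<open>Suc n\<close>, so only its coefficient there counts.\<close>
    have X: "L (pCons 0 (P (Suc n) * P j)) = coeff (pCons 0 (P j)) (Suc n) * h (Suc n)" if "j \<le> n"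
      using that L_P_mult[of "Suc n" "pCons 0 (P j)"]
      by (simp add: coeff_pCons coeff_P_eq_0 split: nat.split)
    consider "j < n" | "j = n" | "j = Suc n" using j by linarith
    then show "L (R * P j) = 0"
    proof cases
      case 1
      then show ?thesis using R X by (simp add: orthogonal coeff_P_eq_0)
    next
      case 2
      then show ?thesis using R X by (simp add: h_Suc flip: h_def)
    next
      case 3
      then show ?thesis using R by (simp add: L_X_P_P orthogonal)
    qed
  qed
  then show ?thesis by (simp add: R_def)
qed

section \<open>Matrix elements of odd powers of x and the string equation\<close>

lemma L_pderiv_P_mult: "L (pderiv (P (Suc n)) * P n) = real (Suc n) * h n"
proof -
  have "L (P n * pderiv (P (Suc n))) = coeff (pderiv (P (Suc n))) n * h n"
    by (rule L_P_mult) (simp add: coeff_pderiv coeff_P_eq_0)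
  then show ?thesis
    by (simp add: coeff_pderiv mult.commute[of "P n"])
qed

lemma L_X1_P_P: "L (pCons 0 (P (Suc n) * P n)) = \<beta> (Suc n) * h n"
proof -
  have "pCons 0 (P (Suc n) * P n) = pCons 0 (P (Suc n)) * P n" by simp
  then show ?thesis
    unfolding three_term_recurrence
    by (simp add: distrib_right L_add L_smult orthogonal flip: h_def)
qed

lemma X_X_P:
  "pCons 0 (pCons 0 (P (Suc (Suc n)))) =
     P (Suc (Suc (Suc (Suc n)))) + smult (\<beta> (Suc (Suc (Suc n))) + \<beta> (Suc (Suc n))) (P (Suc (Suc n)))
       + smult (\<beta> (Suc (Suc n)) * \<beta> (Suc n)) (P n)"
proof -
  have "pCons 0 (pCons 0 (P (Suc (Suc n)))) =
     pCons 0 (P (Suc (Suc (Suc n)))) + smult (\<beta> (Suc (Suc n))) (pCons 0 (P (Suc n)))"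
    by (subst three_term_recurrence) simp
  then show ?thesis
    by (simp only: three_term_recurrence) (simp add: algebra_simps smult_add_left smult_add_right)
qed

text \<open>The index \<open>n + 3\<close> is the least for which three downward steps of the
  recurrence stay within the natural numbers.\<close>

lemma X_X_X_P:
  "pCons 0 (pCons 0 (pCons 0 (P (n + 3)))) =
     P (n + 6) + smult (\<beta> (n + 5) + \<beta> (n + 4) + \<beta> (n + 3)) (P (n + 4))
       + smult (\<beta> (n + 3) * (\<beta> (n + 4) + \<beta> (n + 3) + \<beta> (n + 2))) (P (n + 2))
       + smult (\<beta> (n + 3) * \<beta> (n + 2) * \<beta> (n + 1)) (P n)"
proof -
  have "pCons 0 (pCons 0 (pCons 0 (P (n + 3)))) =
     pCons 0 (pCons 0 (P (Suc (Suc (n + 2))))) + smult (\<beta> (n + 3)) (pCons 0 (pCons 0 (P (Suc (Suc n)))))"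
    using three_term_recurrence[of "n + 2"] by (simp add: eval_nat_numeral)
  then show ?thesis
    by (simp only: X_X_P) (simp add: algebra_simps smult_add_left smult_add_right eval_nat_numeral)
qed

lemma L_X3_P_P:
  "L (pCons 0 (pCons 0 (pCons 0 (P (n + 3) * P (n + 2))))) =
     \<beta> (n + 3) * (\<beta> (n + 4) + \<beta> (n + 3) + \<beta> (n + 2)) * h (n + 2)"
proof -
  have "pCons 0 (pCons 0 (pCons 0 (P (n + 3) * P (n + 2)))) =
      pCons 0 (pCons 0 (pCons 0 (P (n + 3)))) * P (n + 2)" by simp
  then show ?thesis
    unfolding X_X_X_P
    by (simp add: distrib_right L_add L_smult orthogonal flip: h_def)
qed

text \<open>Three factors x go to \<open>P (n + 3)\<close> and two to \<open>P (n + 2)\<close>. The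
  two expansions share only \<open>P (n + 4)\<close>, \<open>P (n + 2)\<close> and
  \<open>P n\<close>, and \<open>h_Suc\<close> reduces their norms to
  \<open>h (n + 2)\<close>.\<close>

lemma L_X5_P_P:
  "L (pCons 0 (pCons 0 (pCons 0 (pCons 0 (pCons 0 (P (n + 3) * P (n + 2))))))) =
     \<beta> (n + 3) * (\<beta> (n + 1) * \<beta> (n + 2) + \<beta> (n + 2) ^ 2 + 2 * \<beta> (n + 2) * \<beta> (n + 3)
       + \<beta> (n + 2) * \<beta> (n + 4) + \<beta> (n + 3) ^ 2 + 2 * \<beta> (n + 3) * \<beta> (n + 4)
       + \<beta> (n + 4) ^ 2 + \<beta> (n + 4) * \<beta> (n + 5)) * h (n + 2)"
proof -
  have "pCons 0 (pCons 0 (pCons 0 (pCons 0 (pCons 0 (P (n + 3) * P (n + 2)))))) =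
      pCons 0 (pCons 0 (pCons 0 (P (n + 3)))) * pCons 0 (pCons 0 (P (Suc (Suc n))))"
    by (simp add: mult.commute)
  then have "L (pCons 0 (pCons 0 (pCons 0 (pCons 0 (pCons 0 (P (n + 3) * P (n + 2))))))) =
      (\<beta> (n + 5) + \<beta> (n + 4) + \<beta> (n + 3)) * h (n + 4)
      + \<beta> (n + 3) * (\<beta> (n + 4) + \<beta> (n + 3) + \<beta> (n + 2)) * (\<beta> (n + 3) + \<beta> (n + 2)) * h (n + 2)
      + \<beta> (n + 3) * \<beta> (n + 2) * \<beta> (n + 1) * (\<beta> (n + 2) * \<beta> (n + 1) * h n)"
    unfolding X_X_X_P X_X_P
    by (simp add: distrib_right distrib_left L_add L_smult orthogonal eval_nat_numeral flip: h_def)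
  also have "\<beta> (n + 2) * \<beta> (n + 1) * h n = h (n + 2)"
    by (simp add: h_Suc)
  also have "h (n + 4) = \<beta> (n + 4) * \<beta> (n + 3) * h (n + 2)"
    by (simp add: h_Suc eval_nat_numeral)
  finally show ?thesis
    by (simp add: algebra_simps power2_eq_square)
qed

lemma string_equation:
  assumes by_parts: "\<And>p. L (pderiv p) = L ([:0, - 2 * t, 0, - 4 * \<tau>, 0, 6:] * p)"
  shows "6 * \<beta> (n + 3) * (\<beta> (n + 1) * \<beta> (n + 2) + \<beta> (n + 2) ^ 2 + 2 * \<beta> (n + 2) * \<beta> (n + 3)
       + \<beta> (n + 2) * \<beta> (n + 4) + \<beta> (n + 3) ^ 2 + 2 * \<beta> (n + 3) * \<beta> (n + 4)
       + \<beta> (n + 4) ^ 2 + \<beta> (n + 4) * \<beta> (n + 5))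
     - 4 * \<tau> * \<beta> (n + 3) * (\<beta> (n + 2) + \<beta> (n + 3) + \<beta> (n + 4)) - 2 * t * \<beta> (n + 3) = real (n + 3)"
    (is "?lhs = _")
proof -
  let ?Q = "P (n + 3) * P (n + 2)"
  \<comment> \<open>This half of the product rule vanishes by degree; the other half supplies
    \<open>real (n + 3)\<close>.\<close>
  have "L (P (n + 3) * pderiv (P (n + 2))) = 0"
    by (rule L_P_mult_eq_0) (simp add: coeff_pderiv coeff_P_eq_0)
  then have "real (n + 3) * h (n + 2) = L (pderiv ?Q)"
    using L_pderiv_P_mult[of "n + 2"]
    by (simp add: pderiv_mult L_add eval_nat_numeral mult.commute)
  also have "\<dots> = L ([:0, - 2 * t, 0, - 4 * \<tau>, 0, 6:] * ?Q)"
    by (rule by_parts)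
  also have "[:0, - 2 * t, 0, - 4 * \<tau>, 0, 6:] * ?Q =
      smult (- 2 * t) (pCons 0 ?Q) + smult (- 4 * \<tau>) (pCons 0 (pCons 0 (pCons 0 ?Q)))
      + smult 6 (pCons 0 (pCons 0 (pCons 0 (pCons 0 (pCons 0 ?Q)))))"
    by (simp add: algebra_simps)
  also have "L \<dots> = ?lhs * h (n + 2)"
    using L_X1_P_P[of "n + 2"]
    unfolding L_add L_smult L_X3_P_P L_X5_P_P by (simp add: eval_nat_numeral algebra_simps)
  finally show ?thesis
    using h_pos[of "n + 2"] by simp
qed

end

section \<open>Asymptotics of the string equation\<close>

text \<open>\<open>A\<close> is the upper limit as a real number, namely the infimum of all eventual
  upper bounds; the two bounds assumed make that set nonempty and bounded below.\<close>

lemma limsup_real_witness: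
  fixes x :: "nat \<Rightarrow> real"
  assumes lower: "\<forall>\<^sub>F n in sequentially. c \<le> x n" and upper: "\<forall>\<^sub>F n in sequentially. x n \<le> d"
  obtains A where "c \<le> A"
    and "\<And>e. e > 0 \<Longrightarrow> \<forall>\<^sub>F n in sequentially. x n \<le> A + e"
    and "\<And>e. e > 0 \<Longrightarrow> \<exists>\<^sub>F n in sequentially. x n > A - e"
proof
  define S where "S = {s. \<forall>\<^sub>F n in sequentially. x n \<le> s}"
  have ne: "S \<noteq> {}" using upper by (auto simp: S_def)
  have lb: "c \<le> s" if "s \<in> S" for s
  proof -
    have "\<forall>\<^sub>F n in sequentially. c \<le> s"
      using lower that unfolding S_def mem_Collect_eq by eventually_elim simp
    then show ?thesis by simp
  qed
  then have bdd: "bdd_below S" by (rule bdd_belowI)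
  show "c \<le> Inf S" using ne lb by (rule cInf_greatest)
  fix e :: real assume e: "e > 0"
  obtain s where "s \<in> S" "s < Inf S + e"
    using e cInf_lessD[OF ne, of "Inf S + e"] by auto
  then show "\<forall>\<^sub>F n in sequentially. x n \<le> Inf S + e"
    unfolding S_def mem_Collect_eq by (elim eventually_mono) auto
  have "Inf S - e \<notin> S"
    using cInf_lower[OF _ bdd, of "Inf S - e"] e by auto
  then show "\<exists>\<^sub>F n in sequentially. x n > Inf S - e"
    by (simp add: S_def frequently_def not_less)
qed

text \<open>One sixth of the cubic part of the string equation, centred at \<open>y2\<close>. It is
  homogeneous of degree 3 and equals 10 y^3 when all arguments are y, whence the 60 in the
  cubic.\<close>

definition freud_form :: "real \<Rightarrow> real \<Rightarrow> real \<Rightarrow> real \<Rightarrow> real \<Rightarrow> real" where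
  "freud_form y0 y1 y2 y3 y4 =
     y2 * (y0 * y1 + y1\<^sup>2 + 2 * y1 * y2 + y1 * y3 + y2\<^sup>2 + 2 * y2 * y3 + y3\<^sup>2 + y3 * y4)"

lemma freud_form_mono:
  assumes "0 \<le> x0" "0 \<le> x1" "0 \<le> x2" "0 \<le> x3" "0 \<le> x4"
    and "x0 \<le> y0" "x1 \<le> y1" "x2 \<le> y2" "x3 \<le> y3" "x4 \<le> y4"
  shows "freud_form x0 x1 x2 x3 x4 \<le> freud_form y0 y1 y2 y3 y4"
  unfolding freud_form_def power2_eq_square
  by (intro mult_mono add_mono add_nonneg_nonneg mult_nonneg_nonneg) (use assms in auto)

lemma freud_form_squeeze:
  assumes "0 \<le> a" "a \<le> A"
    and "freud_form a a A a a \<le> c" "c \<le> freud_form A A a A A"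
  shows "a = A \<and> 10 * A ^ 3 = c"
proof -
  have "(A - a) * (A\<^sup>2 + a\<^sup>2) = freud_form a a A a a - freud_form A A a A A"
    by (simp add: freud_form_def algebra_simps power2_eq_square)
  then have le: "(A - a) * (A\<^sup>2 + a\<^sup>2) \<le> 0" using assms by linarith
  have "a = A"
  proof (rule ccontr)
    assume "a \<noteq> A"
    then have "A - a > 0" "A\<^sup>2 + a\<^sup>2 > 0"
      using assms by (auto simp: add_pos_nonneg)
    then have "(A - a) * (A\<^sup>2 + a\<^sup>2) > 0" by (rule mult_pos_pos)
    then show False using le by linarith
  qed
  then show ?thesis
    using assms by (simp add: freud_form_def power2_eq_square power3_eq_cube)
qed

text \<open>Six times the form is at least \<open>b2 * (2 * S\<^sup>2)\<close>. For
  \<open>b2 > S0\<close> one copy of \<open>b2 * S\<^sup>2\<close> absorbs the terms in \<tau> and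
  t, and the other is at least \<open>b2 ^ 3\<close>.\<close>

lemma recurrence_growth_bound:
  fixes \<tau> t :: real
  obtains S0 where "S0 > 0"
    and "\<And>b0 b1 b2 b3 b4 N. \<lbrakk>b0 > 0; b1 > 0; b2 > 0; b3 > 0; b4 > 0;
      6 * freud_form b0 b1 b2 b3 b4 - 4 * \<tau> * b2 * (b1 + b2 + b3) - 2 * t * b2 = N\<rbrakk>
      \<Longrightarrow> b2 \<le> S0 \<or> b2 ^ 3 \<le> N"
proof
  define S0 where "S0 = 1 + 4 * \<bar>\<tau>\<bar> + 2 * \<bar>t\<bar>"
  show "S0 > 0" by (simp add: S0_def)
  fix b0 b1 b2 b3 b4 N :: real
  assume pos: "b0 > 0" "b1 > 0" "b2 > 0" "b3 > 0" "b4 > 0"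
    and eq: "6 * freud_form b0 b1 b2 b3 b4 - 4 * \<tau> * b2 * (b1 + b2 + b3) - 2 * t * b2 = N"
  define S where "S = b1 + b2 + b3"
  show "b2 \<le> S0 \<or> b2 ^ 3 \<le> N"
  proof (rule disjCI)
    assume "\<not> b2 ^ 3 \<le> N"
    show "b2 \<le> S0"
    proof (rule ccontr)
      assume "\<not> b2 \<le> S0"
      then have S: "S \<ge> S0" using pos by (simp add: S_def)
      then have S1: "S \<ge> 1" by (simp add: S0_def)
      have "(4 * \<bar>\<tau>\<bar> + 2 * \<bar>t\<bar>) * S \<le> S * S"
        using S S1 by (intro mult_right_mono) (auto simp: S0_def)
      moreover have "\<tau> * S \<le> \<bar>\<tau>\<bar> * S" using S1 by (intro mult_right_mono) auto
      moreover have "t \<le> \<bar>t\<bar> * S"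
        using S1 mult_left_mono[of 1 S "\<bar>t\<bar>"] by auto
      ultimately have "4 * \<tau> * S + 2 * t \<le> S\<^sup>2"
        by (simp add: algebra_simps power2_eq_square)
      then have "b2 * (4 * \<tau> * S + 2 * t) \<le> b2 * S\<^sup>2"
        using pos by (intro mult_left_mono) auto
      moreover have "b2 * (2 * S\<^sup>2) \<le> 6 * freud_form b0 b1 b2 b3 b4"
      proof -
        \<comment> \<open>What is left of six times the bracket in \<open>freud_form\<close> after
          subtracting \<open>2 * S\<^sup>2\<close>.\<close>
        have "0 \<le> 6 * (b0 * b1) + 4 * b1\<^sup>2 + 8 * (b1 * b2) + 2 * (b1 * b3)
            + 4 * b2\<^sup>2 + 8 * (b2 * b3) + 4 * b3\<^sup>2 + 6 * (b3 * b4)"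
          using pos by (intro add_nonneg_nonneg mult_nonneg_nonneg) auto
        then have "0 \<le> b2 * (6 * (b0 * b1) + 4 * b1\<^sup>2 + 8 * (b1 * b2) + 2 * (b1 * b3)
            + 4 * b2\<^sup>2 + 8 * (b2 * b3) + 4 * b3\<^sup>2 + 6 * (b3 * b4))"
          using pos by (intro mult_nonneg_nonneg) auto
        then show ?thesis
          by (simp add: freud_form_def S_def algebra_simps power2_eq_square)
      qed
      moreover have "b2 * b2\<^sup>2 \<le> b2 * S\<^sup>2"
        using pos by (intro mult_left_mono power_mono) (auto simp: S_def)
      ultimately have "b2 ^ 3 \<le> N"
        unfolding eq[symmetric] S_def[symmetric]
        by (simp add: algebra_simps power2_eq_square power3_eq_cube)
      then show False using \<open>\<not> b2 ^ 3 \<le> N\<close> by simp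
    qed
  qed
qed

lemma freud_recurrence_limit:
  fixes b :: "nat \<Rightarrow> real"
  assumes pos: "\<And>n. b n > 0"
    and eq: "\<And>n. n \<ge> 1 \<Longrightarrow>
      6 * freud_form (b n) (b (n + 1)) (b (n + 2)) (b (n + 3)) (b (n + 4))
      - 4 * \<tau> * b (n + 2) * (b (n + 1) + b (n + 2) + b (n + 3)) - 2 * t * b (n + 2) = real (n + 2)"
  shows "(\<lambda>n. b n / root 3 (real n)) \<longlonglongrightarrow> root 3 (1 / 60)"
proof -
  \<comment> \<open>\<open>y\<close> scales five neighbours by the common cube root belonging to the
    middle index \<open>n + 2\<close>, whereas \<open>z\<close> scales each term by its own.\<close>
  define N where "N n = root 3 (real (n + 2))" for n
  define y where "y j n = b (n + j) / N n" for j n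
  define z where "z n = b n / root 3 (real n)" for n
  have N1: "N n \<ge> 1" for n by (simp add: N_def)
  have N3: "N n ^ 3 = real (n + 2)" for n by (simp add: N_def)
  have z0: "z n \<ge> 0" for n using pos[of n] by (simp add: z_def)
  have y0: "y j n \<ge> 0" for j n using pos[of "n + j"] N1[of n] by (simp add: y_def)
  have y2: "y 2 n = z (n + 2)" for n by (simp add: y_def z_def N_def)
  obtain S0 where S0: "S0 > 0" and growth:
    "\<And>b0 b1 b2 b3 b4 N. \<lbrakk>b0 > 0; b1 > 0; b2 > 0; b3 > 0; b4 > 0;
      6 * freud_form b0 b1 b2 b3 b4 - 4 * \<tau> * b2 * (b1 + b2 + b3) - 2 * t * b2 = N\<rbrakk>
      \<Longrightarrow> b2 \<le> S0 \<or> b2 ^ 3 \<le> N"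
    using recurrence_growth_bound[of \<tau> t] by blast
  \<comment> \<open>As \<open>N n \<ge> 1\<close>, both alternatives of \<open>growth\<close> give
    at most \<open>(S0 + 1) * N n\<close>.\<close>
  define M where "M = S0 + 1"
  have z_le: "z (n + 2) \<le> M" if n: "n \<ge> 1" for n
  proof -
    have "b (n + 2) \<le> S0 \<or> b (n + 2) ^ 3 \<le> N n ^ 3"
      unfolding N3 by (rule growth[OF pos pos pos pos pos eq[OF n]])
    then have "b (n + 2) \<le> S0 \<or> b (n + 2) \<le> N n"
      using N1[of n] pos[of "n + 2"] by (subst (asm) power_mono_iff) auto
    moreover have "S0 * 1 \<le> S0 * N n" using N1[of n] S0 by (intro mult_left_mono) auto
    ultimately have "b (n + 2) \<le> S0 * N n + N n"
      using N1[of n] S0 by linarith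
    then have "b (n + 2) \<le> M * N n"
      by (simp add: M_def algebra_simps)
    then show ?thesis
      using N1[of n] unfolding y2[symmetric] y_def by (simp add: divide_le_eq)
  qed
  have "\<forall>\<^sub>F n in sequentially. z (n + 2) \<le> M"
    using eventually_ge_at_top[of 1] by (rule eventually_mono) (rule z_le)
  then have zM: "\<forall>\<^sub>F n in sequentially. z n \<le> M"
    by (simp only: eventually_sequentially_seg[where P = "\<lambda>n. z n \<le> M"])
  \<comment> \<open>The two scalings differ by a factor tending to 1, and \<open>z\<close> is
    eventually bounded.\<close>
  have y_z: "(\<lambda>n. y j n - z (n + j)) \<longlonglongrightarrow> 0" for j
  proof (rule tendsto_0_le)
    show "(\<lambda>n. root 3 (real (n + j)) / root 3 (real (n + 2)) - 1) \<longlonglongrightarrow> 0"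
      unfolding of_nat_add by real_asymp
    have "\<forall>\<^sub>F n in sequentially. z (n + j) \<le> M"
      using zM by (simp only: eventually_sequentially_seg[where P = "\<lambda>n. z n \<le> M"])
    then show "\<forall>\<^sub>F n in sequentially. norm (y j n - z (n + j))
        \<le> norm (root 3 (real (n + j)) / root 3 (real (n + 2)) - 1) * M"
      using eventually_gt_at_top[of 0]
    proof eventually_elim
      case (elim n)
      have "y j n - z (n + j) = (root 3 (real (n + j)) / root 3 (real (n + 2)) - 1) * z (n + j)"
        using elim by (simp add: y_def z_def N_def field_simps)
      then have "norm (y j n - z (n + j))
          = norm (root 3 (real (n + j)) / root 3 (real (n + 2)) - 1) * z (n + j)"
        using z0[of "n + j"] by (simp add: abs_mult)
      also have "\<dots> \<le> norm (root 3 (real (n + j)) / root 3 (real (n + 2)) - 1) * M"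
        using elim by (intro mult_left_mono) auto
      finally show ?case .
    qed
  qed
  have z_nonneg: "\<forall>\<^sub>F n in sequentially. 0 \<le> z n" using z0 by simp
  obtain A where A0: "0 \<le> A"
    and A_upper: "\<And>e. e > 0 \<Longrightarrow> \<forall>\<^sub>F n in sequentially. z n \<le> A + e"
    and A_freq: "\<And>e. e > 0 \<Longrightarrow> \<exists>\<^sub>F n in sequentially. z n > A - e"
    using limsup_real_witness[OF z_nonneg zM] by blast
  \<comment> \<open>The lower limit of \<open>z\<close> is minus the upper limit of its
    negative.\<close>
  obtain a' where a'M: "- M \<le> a'"
    and a'_upper: "\<And>e. e > 0 \<Longrightarrow> \<forall>\<^sub>F n in sequentially. - z n \<le> a' + e"
    and a'_freq: "\<And>e. e > 0 \<Longrightarrow> \<exists>\<^sub>F n in sequentially. - z n > a' - e"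
    using limsup_real_witness[of "- M" "\<lambda>n. - z n" 0] zM z_nonneg by auto
  define a where "a = - a'"
  have a_lower: "\<forall>\<^sub>F n in sequentially. a - e \<le> z n" if "e > 0" for e
    using a'_upper[OF that] by eventually_elim (simp add: a_def)
  have a_freq: "\<exists>\<^sub>F n in sequentially. z n < a + e" if "e > 0" for e
    using a'_freq[OF that] by (rule frequently_elim1) (simp add: a_def)
  have a0: "0 \<le> a"
  proof (rule field_le_epsilon)
    fix e :: real assume "e > 0"
    then obtain n where "z n < a + e" using frequently_ex[OF a_freq] by blast
    then show "0 \<le> a + e" using z0[of n] by linarith
  qed
  have aA: "a \<le> A"
  proof (rule field_le_epsilon)
    fix e :: real assume e: "e > 0"
    then have "e / 2 > 0" by simp
    from a_lower[OF this] A_upper[OF this]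
    have "\<forall>\<^sub>F n in sequentially. a \<le> A + e" by eventually_elim linarith
    then show "a \<le> A + e" by simp
  qed
  have y_upper: "\<forall>\<^sub>F n in sequentially. y j n \<le> A + e" if "e > 0" for j e
  proof -
    have "\<forall>\<^sub>F n in sequentially. \<bar>y j n - z (n + j)\<bar> < e / 2"
      using tendstoD[OF y_z[of j], of "e / 2"] that by (simp add: dist_real_def)
    moreover have "\<forall>\<^sub>F n in sequentially. z (n + j) \<le> A + e / 2"
      using A_upper[OF half_gt_zero[OF that]]
      by (simp only: eventually_sequentially_seg[where P = "\<lambda>n. z n \<le> A + e / 2"])
    ultimately show ?thesis by eventually_elim linarith
  qed
  \<comment> \<open>The cut at 0 keeps the bounds nonnegative, as \<open>freud_form_mono\<close>
    demands, even if \<open>a - e\<close> is negative.\<close>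
  have y_lower: "\<forall>\<^sub>F n in sequentially. max 0 (a - e) \<le> y j n" if "e > 0" for j e
  proof -
    have "\<forall>\<^sub>F n in sequentially. \<bar>y j n - z (n + j)\<bar> < e / 2"
      using tendstoD[OF y_z[of j], of "e / 2"] that by (simp add: dist_real_def)
    moreover have "\<forall>\<^sub>F n in sequentially. a - e / 2 \<le> z (n + j)"
      using a_lower[OF half_gt_zero[OF that]]
      by (simp only: eventually_sequentially_seg[where P = "\<lambda>n. a - e / 2 \<le> z n"])
    ultimately show ?thesis
    proof eventually_elim
      case (elim n)
      then show ?case using y0[of j n] by linarith
    qed
  qed
  define E where "E n = freud_form (y 0 n) (y 1 n) (y 2 n) (y 3 n) (y 4 n)" for n
  \<comment> \<open>Dividing the string equation by \<open>N n ^ 3\<close> leaves 1/6 plus terms of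
    order \<open>1 / N n\<close>, the \<open>y j n\<close> being eventually at most
    \<open>K\<close>.\<close>
  have E_lim: "E \<longlonglongrightarrow> 1 / 6"
  proof -
    define K where "K = A + 1"
    have K: "K > 0" using A0 by (simp add: K_def)
    have "(\<lambda>n. E n - 1 / 6) \<longlonglongrightarrow> 0"
    proof (rule tendsto_0_le)
      show "(\<lambda>n. 1 / N n) \<longlonglongrightarrow> 0"
        unfolding N_def of_nat_add by real_asymp
      show "\<forall>\<^sub>F n in sequentially. norm (E n - 1 / 6)
          \<le> norm (1 / N n) * ((4 * \<bar>\<tau>\<bar> * (K * (K + K + K)) + 2 * \<bar>t\<bar> * K) / 6)"
        using y_upper[OF zero_less_one, of 1] y_upper[OF zero_less_one, of 2]
          y_upper[OF zero_less_one, of 3] eventually_ge_at_top[of 1]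
      proof eventually_elim
        case (elim n)
        have N0: "N n > 0" using N1[of n] by linarith
        have b: "b (n + j) = N n * y j n" for j
          using N0 by (simp add: y_def)
        have "N n ^ 3 * (6 * E n) =
            N n ^ 3 * (1 + 4 * \<tau> / N n * (y 2 n * (y 1 n + y 2 n + y 3 n)) + 2 * t / (N n)\<^sup>2 * y 2 n)"
          using eq[OF elim(4)] b[of 0] b[of 1] b[of 2] b[of 3] b[of 4] N0 unfolding N3[symmetric]
          by (simp add: E_def freud_form_def field_simps power2_eq_square power3_eq_cube)
        then have "6 * E n =
            1 + 4 * \<tau> / N n * (y 2 n * (y 1 n + y 2 n + y 3 n)) + 2 * t / (N n)\<^sup>2 * y 2 n"
          using N0 by (subst (asm) mult_cancel_left) simp
        then have "E n - 1 / 6 = 1 / N n *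
            ((4 * \<tau> * (y 2 n * (y 1 n + y 2 n + y 3 n)) + 2 * t * (y 2 n / N n)) / 6)"
          using N0 by (simp add: field_simps power2_eq_square)
        also have "norm \<dots> = norm (1 / N n) *
            (\<bar>4 * \<tau> * (y 2 n * (y 1 n + y 2 n + y 3 n)) + 2 * t * (y 2 n / N n)\<bar> / 6)"
          by (simp add: abs_mult)
        also have "\<dots> \<le> norm (1 / N n) * ((4 * \<bar>\<tau>\<bar> * (K * (K + K + K)) + 2 * \<bar>t\<bar> * K) / 6)"
        proof (intro mult_left_mono divide_right_mono)
          have abs_le: "\<bar>c * x\<bar> \<le> \<bar>c\<bar> * d" if "0 \<le> x" "x \<le> d" for c x d :: real
            using that by (simp add: abs_mult mult_left_mono)
          have "y 2 n * (y 1 n + y 2 n + y 3 n) \<le> K * (K + K + K)"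
            using elim y0[of 1 n] y0[of 2 n] y0[of 3 n] K
            by (intro mult_mono add_mono) (auto simp: K_def)
          then have 1: "\<bar>4 * \<tau> * (y 2 n * (y 1 n + y 2 n + y 3 n))\<bar> \<le> 4 * \<bar>\<tau>\<bar> * (K * (K + K + K))"
            using abs_le[of "y 2 n * (y 1 n + y 2 n + y 3 n)" "K * (K + K + K)" "4 * \<tau>"]
              y0[of 1 n] y0[of 2 n] y0[of 3 n] by (simp add: abs_mult)
          have "y 2 n / N n \<le> y 2 n"
            using y0[of 2 n] N1[of n] mult_left_mono[of 1 "N n" "y 2 n"] by (simp add: divide_le_eq)
          also have "\<dots> \<le> K" using elim by (simp add: K_def)
          finally have 2: "\<bar>2 * t * (y 2 n / N n)\<bar> \<le> 2 * \<bar>t\<bar> * K"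
            using abs_le[of "y 2 n / N n" K "2 * t"] y0[of 2 n] N0 by (simp add: abs_mult)
          show "\<bar>4 * \<tau> * (y 2 n * (y 1 n + y 2 n + y 3 n)) + 2 * t * (y 2 n / N n)\<bar>
              \<le> 4 * \<bar>\<tau>\<bar> * (K * (K + K + K)) + 2 * \<bar>t\<bar> * K"
            using 1 2 by linarith
        qed auto
        finally show ?case .
      qed
    qed
    then show ?thesis by (simp add: LIM_zero_iff)
  qed
  have E_near: "\<forall>\<^sub>F n in sequentially. \<bar>E n - 1 / 6\<bar> < e" if "e > 0" for e
    using tendstoD[OF E_lim that] by (simp add: dist_real_def)
  have y2_freq: "\<exists>\<^sub>F n in sequentially. Q (y 2 n)" if "\<exists>\<^sub>F n in sequentially. Q (z n)" for Q
    using that unfolding frequently_def y2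
    by (simp only: eventually_sequentially_seg[where P = "\<lambda>n. \<not> Q (z n)"] not_False_eq_True)
  have upper_step: "freud_form (max 0 (a - e)) (max 0 (a - e)) (max 0 (A - e)) (max 0 (a - e)) (max 0 (a - e))
      \<le> 1 / 6 + e" if e: "e > 0" for e
  proof -
    \<comment> \<open>Only one frequent condition can be joined with eventual ones, so just the
      middle term is placed near \<open>A\<close>; the neighbours get the bound valid
      eventually.\<close>
    have "\<exists>\<^sub>F n in sequentially. y 2 n > A - e \<and> (max 0 (a - e) \<le> y 0 n \<and> max 0 (a - e) \<le> y 1 n \<and>
        max 0 (a - e) \<le> y 3 n \<and> max 0 (a - e) \<le> y 4 n \<and> \<bar>E n - 1 / 6\<bar> < e)"
      using y_lower[OF e] E_near[OF e] y2_freq[OF A_freq[OF e]]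
      by (intro frequently_eventually_frequently eventually_conj)
    then obtain n where n: "y 2 n > A - e" "max 0 (a - e) \<le> y 0 n" "max 0 (a - e) \<le> y 1 n"
        "max 0 (a - e) \<le> y 3 n" "max 0 (a - e) \<le> y 4 n" "\<bar>E n - 1 / 6\<bar> < e"
      by (auto dest: frequently_ex)
    then have "freud_form (max 0 (a - e)) (max 0 (a - e)) (max 0 (A - e)) (max 0 (a - e)) (max 0 (a - e)) \<le> E n"
      unfolding E_def using y0[of 2 n] by (intro freud_form_mono) auto
    then show ?thesis using n by linarith
  qed
  have lower_step: "1 / 6 - e \<le> freud_form (A + e) (A + e) (a + e) (A + e) (A + e)" if e: "e > 0" for e
  proof -
    have "\<exists>\<^sub>F n in sequentially. y 2 n < a + e \<and> (y 0 n \<le> A + e \<and> y 1 n \<le> A + e \<and>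
        y 3 n \<le> A + e \<and> y 4 n \<le> A + e \<and> \<bar>E n - 1 / 6\<bar> < e)"
      using y_upper[OF e] E_near[OF e] y2_freq[OF a_freq[OF e]]
      by (intro frequently_eventually_frequently eventually_conj)
    then obtain n where n: "y 2 n < a + e" "y 0 n \<le> A + e" "y 1 n \<le> A + e"
        "y 3 n \<le> A + e" "y 4 n \<le> A + e" "\<bar>E n - 1 / 6\<bar> < e"
      by (auto dest: frequently_ex)
    then have "E n \<le> freud_form (A + e) (A + e) (a + e) (A + e) (A + e)"
      unfolding E_def using y0 by (intro freud_form_mono) auto
    then show ?thesis using n by linarith
  qed
  \<comment> \<open>Both inequalities now pass to the limit as \<open>e\<close> tends to 0 from the
    right, the form being continuous.\<close>
  have ev: "\<forall>\<^sub>F e::real in at_right 0. e > 0"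
    by (simp add: eventually_at_right_less)
  have "((\<lambda>e. freud_form (max 0 (a - e)) (max 0 (a - e)) (max 0 (A - e)) (max 0 (a - e)) (max 0 (a - e)))
      \<longlongrightarrow> freud_form (max 0 (a - 0)) (max 0 (a - 0)) (max 0 (A - 0)) (max 0 (a - 0)) (max 0 (a - 0))) (at_right 0)"
    unfolding freud_form_def by (intro tendsto_intros tendsto_max)
  moreover have "((\<lambda>e. 1 / 6 + e) \<longlongrightarrow> 1 / 6 + (0::real)) (at_right 0)"
    by (intro tendsto_intros)
  ultimately have "freud_form (max 0 (a - 0)) (max 0 (a - 0)) (max 0 (A - 0)) (max 0 (a - 0)) (max 0 (a - 0))
      \<le> 1 / 6 + 0"
    using eventually_mono[OF ev upper_step]
    by (intro tendsto_le[OF trivial_limit_at_right_real])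
  then have upper: "freud_form a a A a a \<le> 1 / 6" using a0 A0 by simp
  have "((\<lambda>e. freud_form (A + e) (A + e) (a + e) (A + e) (A + e))
      \<longlongrightarrow> freud_form (A + 0) (A + 0) (a + 0) (A + 0) (A + 0)) (at_right 0)"
    unfolding freud_form_def by (intro tendsto_intros)
  moreover have "((\<lambda>e. 1 / 6 - e) \<longlongrightarrow> 1 / 6 - (0::real)) (at_right 0)"
    by (intro tendsto_intros)
  ultimately have "1 / 6 - 0 \<le> freud_form (A + 0) (A + 0) (a + 0) (A + 0) (A + 0)"
    using eventually_mono[OF ev lower_step]
    by (intro tendsto_le[OF trivial_limit_at_right_real])
  then have lower: "1 / 6 \<le> freud_form A A a A A" by simp
  \<comment> \<open>The \<open>aA\<close> used in the proof is the earlier inequality; afterwards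
    the name denotes this equality.\<close>
  have aA: "a = A" and "10 * A ^ 3 = 1 / 6"
    using freud_form_squeeze[OF a0 aA upper lower] by auto
  then have "A ^ 3 = 1 / 60" by simp
  then have "A = root 3 (1 / 60)"
    using A0 real_root_pos_unique[of 3 A "1 / 60"] by simp
  moreover have "z \<longlonglongrightarrow> A"
  proof (rule tendstoI)
    fix e :: real assume e: "e > 0"
    then have "e / 2 > 0" by simp
    from A_upper[OF this] a_lower[OF this]
    show "\<forall>\<^sub>F n in sequentially. dist (z n) A < e"
      by eventually_elim (use e aA in \<open>auto simp: dist_real_def abs_less_iff\<close>)
  qed
  ultimately show ?thesis by (simp add: z_def [abs_def])
qed

section \<open>The root of the cubic\<close>

text \<open>The difference of the values is \<open>b - c\<close> times 60(b^2 + bc + c^2) - 12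
  \<tau> (b + c) - 2t, and the second factor is positive in this range.\<close>

lemma cubic_strict_mono:
  assumes "1 + \<bar>\<tau>\<bar> + \<bar>t\<bar> \<le> c" "c < b"
  shows "cubic \<tau> t c < cubic \<tau> t b"
proof -
  have pos: "1 \<le> b" "1 \<le> c" using assms by auto
  have "\<tau> * (b + c) \<le> \<bar>\<tau>\<bar> * (b + c)" using pos by (intro mult_right_mono) auto
  also have "\<bar>\<tau>\<bar> * (b + c) \<le> b * b + c * c"
    using assms pos by (auto simp: distrib_left intro!: add_mono mult_right_mono)
  finally have 1: "\<tau> * (b + c) \<le> b * b + c * c" .
  have "t \<le> b * 1" using assms by simp
  also have "b * 1 \<le> b * c" using pos by (intro mult_left_mono) auto
  finally have 2: "t \<le> b * c" .
  have 3: "b * b > 0" "b * c > 0" "c * c > 0" using pos by auto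
  have "60 * (b * b + b * c + c * c) - 12 * (\<tau> * (b + c)) - 2 * t > 0"
    using 1 2 3 unfolding distrib_left by linarith
  then have "(b - c) * (60 * (b * b + b * c + c * c) - 12 * (\<tau> * (b + c)) - 2 * t) > 0"
    using assms by (intro mult_pos_pos) auto
  then show ?thesis
    by (simp add: cubic_def algebra_simps power2_eq_square power3_eq_cube)
qed

text \<open>The cubic is at most 0 far to the left and bounded in between. Hence a root for large
  \<open>n\<close> must exceed any prescribed \<open>B\<close>, which serves both uniqueness and
  divergence of the roots.\<close>

lemma cubic_bounded_above_atMost:
  fixes B :: real
  obtains K where "\<And>b. b \<le> B \<Longrightarrow> cubic \<tau> t b \<le> K"
proof
  define C where "C = 1 + \<bar>\<tau>\<bar> + \<bar>t\<bar> + \<bar>B\<bar>"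
  fix b assume b: "b \<le> B"
  have C0: "C \<ge> 0" by (simp add: C_def)
  show "cubic \<tau> t b \<le> 60 * C ^ 3 + 12 * \<bar>\<tau>\<bar> * C ^ 2 + 2 * \<bar>t\<bar> * C"
  proof (cases "\<bar>b\<bar> \<le> C")
    case True
    have "cubic \<tau> t b \<le> \<bar>60 * b ^ 3\<bar> + \<bar>12 * \<tau> * b ^ 2\<bar> + \<bar>2 * t * b\<bar>"
      unfolding cubic_def by linarith
    also have "\<dots> = 60 * \<bar>b\<bar> ^ 3 + 12 * \<bar>\<tau>\<bar> * \<bar>b\<bar> ^ 2 + 2 * \<bar>t\<bar> * \<bar>b\<bar>"
      by (simp add: abs_mult power_abs)
    also have "\<dots> \<le> 60 * C ^ 3 + 12 * \<bar>\<tau>\<bar> * C ^ 2 + 2 * \<bar>t\<bar> * C"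
      using True by (intro add_mono mult_left_mono power_mono) auto
    finally show ?thesis .
  next
    case False
    define s where "s = - b"
    have s: "s > C" using False b by (auto simp: s_def C_def)
    then have s1: "s \<ge> 1" "s \<ge> \<bar>\<tau>\<bar>" "s \<ge> \<bar>t\<bar>" by (auto simp: C_def)
    have "\<bar>\<tau>\<bar> * s \<le> s * s" using s1 by (intro mult_right_mono) auto
    moreover have "- \<tau> * s \<le> \<bar>\<tau>\<bar> * s" using s1 by (intro mult_right_mono) auto
    moreover have "\<bar>t\<bar> * 1 \<le> s * s" using s1 by (intro mult_mono) auto
    ultimately have "0 \<le> 60 * (s * s) + 12 * (\<tau> * s) - 2 * t"
      using zero_le_square[of s] by linarith
    then have "0 \<le> s * (60 * (s * s) + 12 * (\<tau> * s) - 2 * t)"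
      using s1 by (intro mult_nonneg_nonneg) auto
    then have "cubic \<tau> t b \<le> 0"
      by (simp add: cubic_def s_def algebra_simps power2_eq_square power3_eq_cube)
    also have "0 \<le> 60 * C ^ 3 + 12 * \<bar>\<tau>\<bar> * C ^ 2 + 2 * \<bar>t\<bar> * C" using C0 by simp
    finally show ?thesis .
  qed
qed

lemma cubic_at_top: "filterlim (cubic \<tau> t) at_top at_top"
  unfolding cubic_def by real_asymp

lemma eventually_cubic_unique_root:
  "\<forall>\<^sub>F n in sequentially. \<exists>!b. cubic \<tau> t b = real n"
proof -
  define B where "B = 1 + \<bar>\<tau>\<bar> + \<bar>t\<bar>"
  obtain K where K: "\<And>b. b \<le> B \<Longrightarrow> cubic \<tau> t b \<le> K"
    using cubic_bounded_above_atMost[of B] by blast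
  have "\<forall>\<^sub>F n in sequentially. real n > K"
    using filterlim_real_sequentially by (simp add: filterlim_at_top_dense)
  then show ?thesis
  proof eventually_elim
    case (elim n)
    have "\<forall>\<^sub>F b in at_top. cubic \<tau> t b \<ge> real n \<and> b \<ge> B"
      using cubic_at_top[of \<tau> t] eventually_ge_at_top[of B]
      by (simp add: filterlim_at_top eventually_conj)
    then obtain c where c: "cubic \<tau> t c \<ge> real n" "c \<ge> B"
      by (auto dest: eventually_happens)
    have "\<exists>b. B \<le> b \<and> b \<le> c \<and> cubic \<tau> t b = real n"
    proof (rule IVT')
      show "cubic \<tau> t B \<le> real n" using K[of B] elim by simp
      show "continuous_on {B..c} (cubic \<tau> t)"
        unfolding cubic_def by (intro continuous_intros)
    qed (use c in auto)
    then obtain b where b: "cubic \<tau> t b = real n" by blast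
    show ?case
    proof (rule ex1I[of _ b])
      fix b' assume b': "cubic \<tau> t b' = real n"
      \<comment> \<open>The level \<open>real n\<close> exceeds \<open>K\<close>, so both roots lie
        where the cubic is strictly increasing.\<close>
      have "b > B" "b' > B" using K b b' elim by (fastforce simp: not_le[symmetric])+
      then show "b' = b"
        using cubic_strict_mono[of \<tau> t b b'] cubic_strict_mono[of \<tau> t b' b] b b'
        by (cases b b' rule: linorder_cases) (auto simp: B_def)
    qed (rule b)
  qed
qed

text \<open>The description in \<open>beta_root\<close> is meaningful only once the root is unique,
  hence only eventually.\<close>

lemma cubic_beta_root: "\<forall>\<^sub>F n in sequentially. cubic \<tau> t (beta_root \<tau> t n) = real n"
  using eventually_cubic_unique_root
  by eventually_elim (unfold beta_root_def, rule theI')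

lemma beta_root_at_top: "filterlim (beta_root \<tau> t) at_top sequentially"
  unfolding filterlim_at_top
proof
  fix Z :: real
  obtain K where K: "\<And>b. b \<le> Z \<Longrightarrow> cubic \<tau> t b \<le> K"
    using cubic_bounded_above_atMost[of Z] by blast
  have "\<forall>\<^sub>F n in sequentially. real n > K"
    using filterlim_real_sequentially by (simp add: filterlim_at_top_dense)
  then show "\<forall>\<^sub>F n in sequentially. Z \<le> beta_root \<tau> t n"
    using cubic_beta_root[of \<tau> t]
  proof eventually_elim
    case (elim n)
    then show ?case using K[of "beta_root \<tau> t n"] by linarith
  qed
qed

text \<open>At the root, n / b^3 is the cubic divided by b^3, which tends to 60 because the roots
  diverge.\<close>

lemma root_over_beta_root: "(\<lambda>n. root 3 (real n) / beta_root \<tau> t n) \<longlonglongrightarrow> root 3 60"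
proof -
  have "((\<lambda>b. root 3 (cubic \<tau> t b / b ^ 3)) \<longlongrightarrow> root 3 60) at_top"
    unfolding cubic_def by (intro tendsto_real_root) real_asymp
  then have "(\<lambda>n. root 3 (cubic \<tau> t (beta_root \<tau> t n) / beta_root \<tau> t n ^ 3)) \<longlonglongrightarrow> root 3 60"
    using beta_root_at_top by (rule filterlim_compose)
  moreover have "\<forall>\<^sub>F n in sequentially. root 3 (cubic \<tau> t (beta_root \<tau> t n) / beta_root \<tau> t n ^ 3)
      = root 3 (real n) / beta_root \<tau> t n"
    using cubic_beta_root[of \<tau> t]
    by eventually_elim (simp add: real_root_divide odd_real_root_power_cancel)
  ultimately show ?thesis
    by (rule Lim_transform_eventually)
qed

section \<open>The limit\<close>

theorem theorem3p4:
  fixes \<tau> t :: real and P :: "nat \<Rightarrow> real poly"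
  assumes "monic_OPS (weight \<tau> t) P"
  shows "(\<forall>\<^sub>F n in sequentially. (\<exists>!b. cubic \<tau> t b = real n) \<and> beta_root \<tau> t n > 0)
         \<and> ((\<lambda>n. rec_coeff (weight \<tau> t) P n / beta_root \<tau> t n) \<longlonglongrightarrow> 1)"
proof
  \<comment> \<open>Positivity comes from divergence of the roots to infinity.\<close>
  have root_pos: "\<forall>\<^sub>F n in sequentially. beta_root \<tau> t n > 0"
    using beta_root_at_top[of \<tau> t] by (simp add: filterlim_at_top_dense)
  with eventually_cubic_unique_root[of \<tau> t]
  show "\<forall>\<^sub>F n in sequentially. (\<exists>!b. cubic \<tau> t b = real n) \<and> beta_root \<tau> t n > 0"
    by (rule eventually_conj)
  have wip: "wip (weight \<tau> t) p q = weight_functional \<tau> t (p * q)" for p q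
    by (simp add: wip_def weight_functional_def)
  have degree: "degree (P n) = n" and lead: "lead_coeff (P n) = 1" for n
    using assms unfolding monic_OPS_def by blast+
  have orth: "weight_functional \<tau> t (P m * P n) = 0" if "m \<noteq> n" for m n
    using assms that by (simp add: monic_OPS_def wip)
  interpret even_orthogonal_polys "weight_functional \<tau> t" P
    by unfold_locales
      (fact weight_functional_add weight_functional_smult weight_functional_reflect
        weight_functional_square_pos degree lead orth)+
  have rec: "rec_coeff (weight \<tau> t) P n = \<beta> n" for n
    by (simp add: rec_coeff_def hnorm_def wip \<beta>_def h_def)
  have "(\<lambda>n. \<beta> n / root 3 (real n)) \<longlonglongrightarrow> root 3 (1 / 60)"
  proof (rule freud_recurrence_limit[OF \<beta>_pos])
    fix n :: nat assume "n \<ge> 1"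
    \<comment> \<open>\<open>string_equation\<close> at \<open>m\<close> begins with
      \<open>\<beta> (m + 1)\<close>, which is \<open>\<beta> n\<close>; the artificial value
      \<open>\<beta> 0\<close> stays outside.\<close>
    then obtain m where "n = m + 1" by (metis add.commute le_Suc_ex)
    then show "6 * freud_form (\<beta> n) (\<beta> (n + 1)) (\<beta> (n + 2)) (\<beta> (n + 3)) (\<beta> (n + 4))
      - 4 * \<tau> * \<beta> (n + 2) * (\<beta> (n + 1) + \<beta> (n + 2) + \<beta> (n + 3)) - 2 * t * \<beta> (n + 2) = real (n + 2)"
      using string_equation[OF weight_functional_pderiv, of m]
      by (simp add: freud_form_def mult.assoc add.commute add.left_commute eval_nat_numeral)
  qed
  from tendsto_mult[OF this root_over_beta_root[of \<tau> t]]
  have "(\<lambda>n. \<beta> n / root 3 (real n) * (root 3 (real n) / beta_root \<tau> t n)) \<longlonglongrightarrow> 1"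
    by (simp flip: real_root_mult)
  moreover have "\<forall>\<^sub>F n in sequentially. \<beta> n / root 3 (real n) * (root 3 (real n) / beta_root \<tau> t n)
      = rec_coeff (weight \<tau> t) P n / beta_root \<tau> t n"
    \<comment> \<open>Cancelling \<open>root 3 (real n)\<close> requires
      \<open>n > 0\<close>.\<close>
    using eventually_gt_at_top[of 0] by eventually_elim (simp add: rec)
  ultimately show "(\<lambda>n. rec_coeff (weight \<tau> t) P n / beta_root \<tau> t n) \<longlonglongrightarrow> 1"
    by (rule Lim_transform_eventually)
qed

end
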